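(* For each integer $r \geqslant 2$, there exists a constant $C = C(r) > 0$ such that the following holds. If $p = p(n) \in (0,1)$ satisfies $p \gg n^{-2/(r+2)}$ and $t = t(n) \geqslant C/p$, then $$G\big(rn + t, p\big) \to (K_{r+1}, P_n)$$ with high probability as $n \to \infty$.
   Context: $G(N,p)$ denotes the Erdős–Rényi random graph on $N$ vertices in which each pair is an edge independently with probability $p$. $P_n$ is the path with $n$ edges, and $K_{r+1}$ is the complete graph on $r+1$ vertices. For graphs $G, H_1, H_2$, we write $G \to (H_1,H_2)$ if every red-blue colouring of the edges of $G$ contains either a red copy of $H_1$ or a blue copy of $H_2$. For functions $f,g$, $f \gg g$ means $f/g \to \infty$ as $n \to \infty$. "With high probability" means with probability tending to $1$ as $n \to \infty$. *)

theory Defs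
  imports "HOL-Probability.Probability" "HOL-Probability.Product_PMF"
    "HOL-Library.Ramsey"
begin

record 'a graph =
  verts :: "'a set"
  edges :: "'a set set"

definition complete_ugraph :: "nat \<Rightarrow> nat graph" where
  "complete_ugraph m = \<lparr>verts = {..<m}, edges = nsets {..<m} 2\<rparr>"

text \<open>Paths are indexed by their number of edges, so \<open>path_ugraph n\<close> has \<open>n + 1\<close> vertices.\<close>

definition path_ugraph :: "nat \<Rightarrow> nat graph" where
  "path_ugraph n = \<lparr>verts = {..n}, edges = {{i, Suc i} | i. i < n}\<rparr>"

text \<open>Copies are subgraphs in the usual sense, not necessarily induced.\<close>

definition contains_copy :: "'a graph \<Rightarrow> 'b graph \<Rightarrow> bool" where
  "contains_copy G H \<longleftrightarrow>
     (\<exists>\<phi>. inj_on \<phi> (verts H) \<and> \<phi> ` verts H \<subseteq> verts G \<and> (\<forall>e\<in>edges H. \<phi> ` e \<in> edges G))"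

datatype colour = Red | Blue

definition colour_class :: "'a graph \<Rightarrow> ('a set \<Rightarrow> colour) \<Rightarrow> colour \<Rightarrow> 'a graph" where
  "colour_class G \<kappa> c = \<lparr>verts = verts G, edges = {e \<in> edges G. \<kappa> e = c}\<rparr>"

text \<open>A colouring is a total function on vertex sets; only its values on edges of \<open>G\<close> matter.\<close>

definition ramsey_arrow :: "'a graph \<Rightarrow> 'b graph \<Rightarrow> 'c graph \<Rightarrow> bool" where
  "ramsey_arrow G H1 H2 \<longleftrightarrow>
     (\<forall>\<kappa>. contains_copy (colour_class G \<kappa> Red) H1 \<or> contains_copy (colour_class G \<kappa> Blue) H2)"

definition random_graph :: "nat \<Rightarrow> real \<Rightarrow> nat graph pmf" where
  "random_graph N p =
     map_pmf (\<lambda>f. \<lparr>verts = {..<N}, edges = {e \<in> nsets {..<N} 2. f e}\<rparr>)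
       (Pi_pmf (nsets {..<N} 2) False (\<lambda>_. bernoulli_pmf p))"

end

theory Submission
  imports Defs "HOL-Real_Asymp.Real_Asymp"
begin

text \<open>
  Suppose that the blue graph on at least \<open>r n + (r + 1) a\<close> vertices has no path with \<open>n\<close> edges, and
  let \<open>m\<close> be a small multiple of \<open>n\<close>. Then it has a hole: disjoint sets \<open>A\<^sub>0, \<dots>, A\<^sub>r\<close> with
  \<open>|A\<^sub>0| \<ge> a\<close> and \<open>|A\<^sub>i| \<ge> m\<close> for \<open>i \<ge> 1\<close> and no blue edges between them. For the induction on \<open>r\<close>,
  remove a maximal set of size at most \<open>2 a\<close> that does not expand. If it has at least \<open>a\<close> elements,
  it serves as \<open>A\<^sub>0\<close>, and the induction hypothesis with \<open>a = m\<close> applies to its non-neighbours.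
  Otherwise, the set \<open>S\<close> of endpoints that Posa rotations of a longest path produce has a small
  neighbourhood, so it has more than \<open>a\<close> elements, and either it serves as \<open>A\<^sub>0\<close> or \<open>|S| \<ge> m\<close>. In the
  latter case, \<open>S\<close> has no edges to the vertices off the path, to which the induction hypothesis applies.

  On the other hand, take \<open>a\<close> to be a large multiple of \<open>1 / p\<close>. For given \<open>A\<^sub>0, \<dots>, A\<^sub>r\<close>, Janson's
  inequality bounds the probability that no copy of \<open>K\<^bsub>r+1\<^esub>\<close> in \<open>G(N, p)\<close> has one vertex in each part by
  \<open>exp (- c a p n)\<close>: every expected number of partial transversal cliques on \<open>k \<ge> 2\<close> parts is at least
  \<open>a m\<^bsup>k-1\<^esup> p\<^bsup>k(k-1)/2\<^esup>\<close>, which is at least \<open>a p m\<close> because \<open>m\<^sup>2 p\<^bsup>r+2\<^esup> \<ge> 1\<close>. This beats the number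
  \<open>exp (O(n))\<close> of choices of the parts. All edges of a copy of \<open>K\<^bsub>r+1\<^esub>\<close> across a hole are red.
\<close>

section \<open>Posa rotations and multipartite holes\<close>

text \<open>Paths are vertex lists. A step replaces the edge from \<open>v\<close> to
  \<open>hd vs\<close> by the edge from \<open>last vs\<close> to \<open>v\<close>, so the first
  vertex stays fixed and \<open>hd vs\<close> becomes the last one.\<close>

inductive rotation :: "('a \<Rightarrow> 'a \<Rightarrow> bool) \<Rightarrow> 'a list \<Rightarrow> 'a list \<Rightarrow> bool" for R xs where
  refl: "rotation R xs xs"
| step: "rotation R xs (us @ v # vs) \<Longrightarrow> vs \<noteq> [] \<Longrightarrow> R (last vs) v \<Longrightarrow> rotation R xs (us @ v # rev vs)"

text \<open>Unordered pairs make the relation invariant under the list reversal that a rotation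
  performs on its tail.\<close>

fun path_adj :: "'a list \<Rightarrow> 'a \<Rightarrow> 'a \<Rightarrow> bool" where
  "path_adj (x # y # xs) u v \<longleftrightarrow> {u, v} = {x, y} \<or> path_adj (y # xs) u v"
| "path_adj _ u v \<longleftrightarrow> False"

lemma path_adj_nth:
  assumes "path_adj xs u v"
  obtains i where "Suc i < length xs" "{u, v} = {xs ! i, xs ! Suc i}"
proof -
  have "\<exists>i. Suc i < length xs \<and> {u, v} = {xs ! i, xs ! Suc i}"
    using assms
  proof (induction xs u v rule: path_adj.induct)
    case (1 x y xs u v)
    show ?case
    proof (cases "{u, v} = {x, y}")
      case True
      then show ?thesis by (intro exI[of _ 0]) simp
    next
      case False
      then obtain i where "Suc i < length (y # xs)" "{u, v} = {(y # xs) ! i, (y # xs) ! Suc i}"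
        using 1 by auto
      then show ?thesis by (intro exI[of _ "Suc i"]) simp
    qed
  qed auto
  then show ?thesis using that by blast
qed

lemma path_adj_append:
  "path_adj (xs @ ys) u v \<longleftrightarrow> path_adj xs u v \<or> path_adj ys u v \<or>
     (xs \<noteq> [] \<and> ys \<noteq> [] \<and> {u, v} = {last xs, hd ys})"
proof (induction xs)
  case (Cons x xs)
  then show ?case by (cases xs; cases ys) auto
qed auto

lemma path_adj_Cons: "path_adj (x # xs) u v \<longleftrightarrow> xs \<noteq> [] \<and> {u, v} = {x, hd xs} \<or> path_adj xs u v"
  by (cases xs) auto

lemma path_adj_rev: "path_adj (rev xs) u v \<longleftrightarrow> path_adj xs u v"
  by (induction xs) (auto simp: path_adj_append path_adj_Cons last_rev)

lemma card_path_adj: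
  assumes "distinct xs"
  shows "finite {u. path_adj xs u v} \<and> card {u. path_adj xs u v} \<le> 2"
proof (cases "v \<in> set xs")
  case True
  then obtain j where j: "j < length xs" "v = xs ! j" by (metis in_set_conv_nth)
  \<comment> \<open>For \<open>j = 0\<close> the truncated index \<open>j - 1\<close> gives
    \<open>v\<close> itself, and at the last position \<open>xs ! Suc j\<close> is unspecified; both
    are harmless in an upper bound.\<close>
  have sub: "{u. path_adj xs u v} \<subseteq> {xs ! (j - 1), xs ! Suc j}"
  proof
    fix u assume "u \<in> {u. path_adj xs u v}"
    then obtain i where "Suc i < length xs" "{u, v} = {xs ! i, xs ! Suc i}"
      by (auto elim: path_adj_nth)
    with assms j show "u \<in> {xs ! (j - 1), xs ! Suc j}"
      by (auto simp: doubleton_eq_iff nth_eq_iff_index_eq)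
  qed
  have "card {xs ! (j - 1), xs ! Suc j} \<le> 2" by (simp add: card_insert_if)
  with sub show ?thesis by (meson card_mono finite.intros finite_subset le_trans)
next
  case False
  then have "{u. path_adj xs u v} = {}" by (force elim!: path_adj_nth simp: doubleton_eq_iff)
  then show ?thesis by simp
qed

text \<open>Symmetry of \<open>R\<close> allows the tail to be traversed backwards. Equality of
  multisets transfers the vertex set, the length and distinctness at once.\<close>

lemma rotation_path:
  assumes "rotation R xs ys" "symp R" "successively R xs"
  shows "successively R ys \<and> mset ys = mset xs"
  using assms
proof induction
  case (step us v vs)
  then have IH: "successively R (us @ v # vs)" "mset (us @ v # vs) = mset xs" by auto
  have "successively R (rev vs)"
  proof -
    have "successively R vs" using IH(1) by (auto simp: successively_append_iff successively_Cons)
    moreover have "(\<lambda>x y. R y x) = R" using \<open>symp R\<close> by (auto simp: fun_eq_iff symp_def)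
    ultimately show ?thesis by (simp only: successively_rev)
  qed
  moreover have "R v (hd (rev vs))"
    using step by (simp add: hd_rev symp_def)
  ultimately show ?case
    using IH by (auto simp: successively_append_iff successively_Cons)
qed auto

text \<open>As long as neither \<open>u\<close> nor a neighbour of it on \<open>xs\<close> becomes an endpoint, no rotation
  touches the edges at \<open>u\<close>.\<close>

lemma rotation_path_adj:
  assumes "rotation R xs ys" "xs \<noteq> []"
    and u: "\<And>zs. rotation R xs zs \<Longrightarrow> last zs \<noteq> u \<and> \<not> path_adj xs u (last zs)"
    and "path_adj ys u x"
  shows "path_adj xs u x"
  using assms(1,4)
proof (induction arbitrary: x)
  case (step us v vs)
  have "u \<noteq> last vs" using u[OF step(1)] step(2) by auto
  \<comment> \<open>If \<open>u = v\<close>, the rotation would make \<open>hd vs\<close> an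
    endpoint, although by induction \<open>hd vs\<close> is a neighbour of \<open>u\<close> on
    \<open>xs\<close>.\<close>
  moreover have "u \<noteq> v"
  proof
    assume "u = v"
    then have "path_adj (us @ v # vs) u (hd vs)" using step(2) by (cases vs) (auto simp: path_adj_append)
    then have "path_adj xs u (hd vs)" by (rule step.IH)
    moreover have "last (us @ v # rev vs) = hd vs" using step(2) by (simp add: last_rev)
    ultimately show False using u[OF rotation.step[OF step(1-3)]] by simp
  qed
  \<comment> \<open>The only edge that the rotation can create is \<open>{v, last vs}\<close>, and
    it avoids \<open>u\<close>.\<close>
  ultimately have "path_adj (us @ v # vs) u x"
    using step.prems step(2)
    by (auto simp: path_adj_append path_adj_Cons path_adj_rev doubleton_eq_iff hd_rev)
  then show ?case by (rule step.IH)
qed auto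

text \<open>Posa's lemma, with \<open>S\<close> the set of last vertices of all lists reachable by
  rotations. Each of these lists is again a longest path, so it cannot be extended from its last
  vertex.\<close>

lemma posa_rotation_endpoints:
  assumes "symp R" "distinct xs" "successively R xs" "xs \<noteq> []" "set xs \<subseteq> V"
    and longest: "\<And>ys. distinct ys \<Longrightarrow> successively R ys \<Longrightarrow> set ys \<subseteq> V \<Longrightarrow> length ys \<le> length xs"
  obtains S where "S \<noteq> {}" "S \<subseteq> set xs"
    "\<And>x y. x \<in> S \<Longrightarrow> y \<in> V - set xs \<Longrightarrow> \<not> R x y"
    "card {y \<in> V - S. \<exists>x\<in>S. R x y} \<le> 2 * card S"
proof
  define S where "S = last ` {ys. rotation R xs ys}"
  have rot: "successively R ys" "set ys = set xs" "distinct ys" "length ys = length xs" "ys \<noteq> []"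
    if "rotation R xs ys" for ys
  proof -
    have *: "successively R ys" "mset ys = mset xs"
      using rotation_path[OF that \<open>symp R\<close> \<open>successively R xs\<close>] by auto
    show "successively R ys" "set ys = set xs" "distinct ys" "length ys = length xs" "ys \<noteq> []"
      using * mset_eq_setD[OF *(2)] mset_eq_length[OF *(2)] mset_eq_imp_distinct_iff[OF *(2)] assms(2,4)
      by auto
  qed
  show "S \<noteq> {}" by (auto simp: S_def intro: rotation.refl)
  show Sxs: "S \<subseteq> set xs" using rot by (fastforce simp: S_def)
  show out: "\<not> R x y" if "x \<in> S" "y \<in> V - set xs" for x y
  proof
    assume "R x y"
    obtain ys where ys: "rotation R xs ys" "x = last ys" using \<open>x \<in> S\<close> by (auto simp: S_def)
    have "length (ys @ [y]) \<le> length xs"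
      by (rule longest) (use ys rot[OF ys(1)] \<open>R x y\<close> that assms(5) in \<open>auto simp: successively_append_iff\<close>)
    then show False using rot[OF ys(1)] by simp
  qed
  \<comment> \<open>Every neighbour of \<open>S\<close> outside \<open>S\<close> is adjacent to
    \<open>S\<close> along \<open>xs\<close> itself, where each vertex has at most two neighbours.
    Otherwise no rotation would create a new path edge at \<open>y\<close>, so \<open>hd vs\<close>
    would be a neighbour of \<open>y\<close> on \<open>xs\<close>; but rotating at \<open>y\<close>
    puts \<open>hd vs\<close> into \<open>S\<close>.\<close>
  have "{y \<in> V - S. \<exists>x\<in>S. R x y} \<subseteq> (\<Union>x\<in>S. {u. path_adj xs u x})"
  proof (rule subsetI, rule ccontr)
    fix y assume "y \<in> {y \<in> V - S. \<exists>x\<in>S. R x y}" and no: "y \<notin> (\<Union>x\<in>S. {u. path_adj xs u x})"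
    then obtain x where x: "x \<in> S" "R x y" "y \<in> V" "y \<notin> S" by auto
    then have "y \<in> set xs" using out by blast
    obtain ys where ys: "rotation R xs ys" "x = last ys" using \<open>x \<in> S\<close> by (auto simp: S_def)
    then obtain us vs where split: "ys = us @ y # vs"
      using \<open>y \<in> set xs\<close> rot(2) by (metis split_list)
    have "vs \<noteq> []" using split ys x by auto
    have *: "last zs \<noteq> y \<and> \<not> path_adj xs y (last zs)" if "rotation R xs zs" for zs
      using that no x(4) by (auto simp: S_def)
    have "path_adj ys y (hd vs)" using \<open>vs \<noteq> []\<close> split by (cases vs) (auto simp: path_adj_append)
    then have "path_adj xs y (hd vs)"
      using rotation_path_adj[of R xs ys y "hd vs"] ys(1) \<open>xs \<noteq> []\<close> * by blast
    moreover have "rotation R xs (us @ y # rev vs)"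
      using ys x \<open>vs \<noteq> []\<close> by (intro rotation.step) (auto simp: split)
    ultimately show False using * \<open>vs \<noteq> []\<close> by (force simp: last_rev)
  qed
  moreover have "finite S" using Sxs finite_subset by auto
  moreover have "card (\<Union>x\<in>S. {u. path_adj xs u x}) \<le> (\<Sum>x\<in>S. card {u. path_adj xs u x})"
    using \<open>finite S\<close> by (rule card_UN_le)
  moreover have "\<dots> \<le> (\<Sum>x\<in>S. 2)" using card_path_adj[OF assms(2)] by (intro sum_mono) auto
  ultimately show "card {y \<in> V - S. \<exists>x\<in>S. R x y} \<le> 2 * card S"
    using card_path_adj[OF assms(2)] card_mono[of "\<Union>x\<in>S. {u. path_adj xs u x}" "{y \<in> V - S. \<exists>x\<in>S. R x y}"]
    by (simp add: mult.commute)
qed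

section \<open>Multipartite holes in graphs without long paths\<close>

text \<open>\<open>length\<close> counts vertices, so this excludes paths with \<open>n\<close>
  edges, which have \<open>n + 1\<close> vertices.\<close>

definition path_bounded :: "('a \<Rightarrow> 'a \<Rightarrow> bool) \<Rightarrow> 'a set \<Rightarrow> nat \<Rightarrow> bool" where
  "path_bounded R V n \<longleftrightarrow>
     (\<forall>xs. distinct xs \<longrightarrow> successively R xs \<longrightarrow> set xs \<subseteq> V \<longrightarrow> length xs \<le> n)"

text \<open>\<open>A 0\<close> has its own bound because in the application \<open>a\<close> has
  order \<open>1 / p\<close>, whereas \<open>m\<close> is linear in \<open>n\<close>.\<close>

definition multipartite_hole :: "('a \<Rightarrow> 'a \<Rightarrow> bool) \<Rightarrow> nat \<Rightarrow> nat \<Rightarrow> nat \<Rightarrow> 'a set \<Rightarrow> (nat \<Rightarrow> 'a set) \<Rightarrow> bool" where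
  "multipartite_hole R r a m V A \<longleftrightarrow>
     (\<forall>i\<le>r. A i \<subseteq> V) \<and> disjoint_family_on A {..r} \<and>
     a \<le> card (A 0) \<and> (\<forall>i\<in>{1..r}. m \<le> card (A i)) \<and>
     (\<forall>i\<le>r. \<forall>j\<le>r. i \<noteq> j \<longrightarrow> (\<forall>x\<in>A i. \<forall>y\<in>A j. \<not> R x y))"

lemma multipartite_hole_extend_large:
  assumes "multipartite_hole R r a m W A" "symp R" "W \<subseteq> V" "S \<subseteq> V" "S \<inter> W = {}" "m \<le> card S"
    "\<And>x y. x \<in> S \<Longrightarrow> y \<in> W \<Longrightarrow> \<not> R x y"
  shows "multipartite_hole R (Suc r) a m V (A(Suc r := S))"
proof -
  have "A i \<subseteq> W" if "i \<le> r" for i using assms(1) that by (simp add: multipartite_hole_def)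
  then show ?thesis
    using assms unfolding multipartite_hole_def disjoint_family_on_def
    apply (auto simp: le_Suc_eq dest: sympD)
    apply (blast dest: sympD)+
    done
qed

text \<open>Placing \<open>S\<close> at index 0 shifts the old parts up, so the old
  \<open>A 0\<close> has to meet the bound \<open>m\<close> as well; hence the hypothesis has
  \<open>m\<close> in place of \<open>a\<close>.\<close>

lemma multipartite_hole_extend_small:
  assumes "multipartite_hole R r m m W A" "symp R" "W \<subseteq> V" "S \<subseteq> V" "S \<inter> W = {}" "a \<le> card S"
    "\<And>x y. x \<in> S \<Longrightarrow> y \<in> W \<Longrightarrow> \<not> R x y"
  shows "multipartite_hole R (Suc r) a m V (case_nat S A)"
proof -
  have sub: "A i \<subseteq> W" if "i \<le> r" for i using assms(1) that by (simp add: multipartite_hole_def)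
  have "m \<le> card (A i)" if "i \<le> r" for i
    using assms(1) that by (cases i) (auto simp: multipartite_hole_def)
  with sub show ?thesis
    using assms unfolding multipartite_hole_def disjoint_family_on_def
    apply (auto split: nat.splits dest: sympD)
    apply (blast dest: sympD)+
    done
qed

text \<open>Induction on \<open>r\<close> for all \<open>a\<close> and \<open>V\<close>, because one
  case continues with \<open>a = m\<close>. The constant 6 in \<open>(r + 6) * m\<close> pays for a
  removed set of at most \<open>2 * a\<close> vertices together with at most \<open>4 * a\<close>
  neighbours.\<close>

lemma exists_multipartite_hole:
  assumes "symp R" "finite V" "path_bounded R V n" "a \<le> m" "(r + 6) * m \<le> n"
    "r * n + (r + 1) * a \<le> card V"
  shows "\<exists>A. multipartite_hole R r a m V A"
  using assms(2-)
proof (induction r arbitrary: a V)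
  case 0
  then have "multipartite_hole R 0 a m V (\<lambda>_. V)"
    by (auto simp: multipartite_hole_def disjoint_family_on_def)
  then show ?case by blast
next
  case (Suc r)
  define nb where "nb = (\<lambda>U X. {y \<in> U - X. \<exists>x\<in>X. R x y})"
  have bounded: "path_bounded R W n" if "W \<subseteq> V" for W
    using Suc.prems(2) that by (auto simp: path_bounded_def)
  have m: "(r + 6) * m \<le> n" using Suc.prems(4) by (simp add: algebra_simps)
  have nm: "r * m + 7 * m \<le> n" using Suc.prems(4) by (simp add: algebra_simps)
  have card_V: "r * n + n + (r * a + 2 * a) \<le> card V"
    using Suc.prems(5) by (simp add: algebra_simps)
  have fin: "finite W" if "W \<subseteq> V" for W
    using Suc.prems(1) that finite_subset by blast
  \<comment> \<open>A set with at least \<open>a\<close> vertices and few neighbours becomes part 0;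
    the vertices of \<open>U\<close> neither in it nor adjacent to it contain a hole by the
    induction hypothesis with both bounds \<open>m\<close>.\<close>
  have hole_small: "\<exists>A. multipartite_hole R (Suc r) a m V A"
    if "X \<subseteq> U" "U \<subseteq> V" "a \<le> card X" "r * n + (r + 1) * m + card X + card (nb U X) \<le> card U" for X U
  proof -
    define W where "W = U - X - nb U X"
    have "W \<subseteq> V" using that by (auto simp: W_def)
    have "card U \<le> card (X \<union> nb U X) + card W"
    proof -
      have "U \<subseteq> X \<union> nb U X \<union> W" "X \<union> nb U X \<union> W \<subseteq> V"
        using that by (auto simp: W_def nb_def)
      then have "card U \<le> card (X \<union> nb U X \<union> W)" using fin by (intro card_mono) auto
      then show ?thesis using card_Un_le[of "X \<union> nb U X" W] by linarith
    qed
    then have "r * n + (r + 1) * m \<le> card W"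
      using that(4) card_Un_le[of X "nb U X"] by linarith
    then obtain A where "multipartite_hole R r m m W A"
      using Suc.IH[of W m] fin bounded \<open>W \<subseteq> V\<close> m by blast
    then have "multipartite_hole R (Suc r) a m V (case_nat X A)"
      by (rule multipartite_hole_extend_small[OF _ \<open>symp R\<close> \<open>W \<subseteq> V\<close>])
         (use that in \<open>auto simp: W_def nb_def\<close>)
    then show ?thesis by blast
  qed
  \<comment> \<open>With the size limit \<open>2 * a\<close>, a member with fewer than
    \<open>a\<close> vertices can still absorb a non-expanding set of at most \<open>a\<close>
    vertices.\<close>
  define \<X> where "\<X> = {X. X \<subseteq> V \<and> card X \<le> 2 * a \<and> card (nb V X) \<le> 2 * card X}"
  have "{} \<in> \<X>" by (simp add: \<X>_def nb_def)
  moreover have "finite \<X>"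
    using Suc.prems(1) by (intro finite_subset[of \<X> "Pow V"]) (auto simp: \<X>_def)
  ultimately obtain X where X: "X \<in> \<X>" and X_max: "\<forall>Y\<in>\<X>. X \<subseteq> Y \<longrightarrow> X = Y"
    using finite_has_maximal[of \<X>] by blast
  have "X \<subseteq> V" "card X \<le> 2 * a" "card (nb V X) \<le> 2 * card X" using X by (auto simp: \<X>_def)
  show ?case
  proof (cases "a \<le> card X")
    case True
    have "r * n + (r + 1) * m + card X + card (nb V X) \<le> card V"
      using \<open>card X \<le> 2 * a\<close> \<open>card (nb V X) \<le> 2 * card X\<close> card_V nm \<open>a \<le> m\<close>
      by (simp add: algebra_simps)
    then show ?thesis using hole_small[of X V] True \<open>X \<subseteq> V\<close> by blast
  next
    case False
    define U where "U = V - X"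
    have "U \<subseteq> V" by (auto simp: U_def)
    \<comment> \<open>Fewer than \<open>a\<close> vertices were removed, so there remain
      \<open>n\<close> for a longest path plus the \<open>r * n + (r + 1) * a\<close> of the
      induction hypothesis.\<close>
    have card_U: "r * n + n + (r * a + a) < card U"
      using False card_V \<open>X \<subseteq> V\<close> fin by (simp add: U_def card_Diff_subset)
    \<comment> \<open>Otherwise \<open>X \<union> Y\<close> would be a larger member of
      \<open>\<X>\<close>, since its neighbours lie in \<open>nb V X\<close> or in
      \<open>nb U Y\<close>.\<close>
    have expand: "2 * card Y < card (nb U Y)" if "Y \<subseteq> U" "card Y \<le> a" "Y \<noteq> {}" for Y
    proof (rule ccontr)
      assume "\<not> 2 * card Y < card (nb U Y)"
      have fins: "finite X" "finite Y" using that fin \<open>U \<subseteq> V\<close> \<open>X \<subseteq> V\<close> by auto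
      have "card (X \<union> Y) = card X + card Y"
        using that fins by (intro card_Un_disjoint) (auto simp: U_def)
      moreover have "card (nb V (X \<union> Y)) \<le> card (nb V X \<union> nb U Y)"
        by (rule card_mono) (use Suc.prems(1) \<open>U \<subseteq> V\<close> fin in \<open>auto simp: nb_def U_def\<close>)
      ultimately have "X \<union> Y \<in> \<X>"
        using card_Un_le[of "nb V X" "nb U Y"] \<open>\<not> 2 * card Y < card (nb U Y)\<close> False that
          \<open>card (nb V X) \<le> 2 * card X\<close> \<open>X \<subseteq> V\<close> \<open>U \<subseteq> V\<close>
        by (auto simp: \<X>_def)
      then have "Y \<subseteq> X" using X_max by blast
      then show False using that by (auto simp: U_def)
    qed
    define \<P> where "\<P> = {xs. distinct xs \<and> successively R xs \<and> set xs \<subseteq> U}"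
    have len: "length xs \<le> n" if "xs \<in> \<P>" for xs
      using that bounded[OF \<open>U \<subseteq> V\<close>] by (auto simp: \<P>_def path_bounded_def)
    have "[] \<in> \<P>" by (simp add: \<P>_def)
    have "\<exists>xs. xs \<in> \<P> \<and> (\<forall>ys. ys \<in> \<P> \<longrightarrow> length ys \<le> length xs)"
      by (rule ex_has_greatest_nat[of _ "[]" _ "Suc n"]) (use \<open>[] \<in> \<P>\<close> len in \<open>auto simp: less_Suc_eq_le\<close>)
    then obtain xs where xs: "xs \<in> \<P>" and xs_max: "\<And>ys. ys \<in> \<P> \<Longrightarrow> length ys \<le> length xs"
      by blast
    have "xs \<noteq> []"
    proof
      assume "xs = []"
      obtain u where "u \<in> U" using card_U by fastforce
      then have "[u] \<in> \<P>" by (simp add: \<P>_def)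
      then show False using xs_max \<open>xs = []\<close> by fastforce
    qed
    obtain S where S: "S \<noteq> {}" "S \<subseteq> set xs" "card (nb U S) \<le> 2 * card S"
      "\<And>x y. x \<in> S \<Longrightarrow> y \<in> U - set xs \<Longrightarrow> \<not> R x y"
    proof (rule posa_rotation_endpoints[of R xs U])
      show "length ys \<le> length xs" if "distinct ys" "successively R ys" "set ys \<subseteq> U" for ys
        using that by (intro xs_max) (simp add: \<P>_def)
    qed (use \<open>symp R\<close> \<open>xs \<noteq> []\<close> xs in \<open>auto simp: \<P>_def nb_def\<close>)
    have "S \<subseteq> U" using S xs by (auto simp: \<P>_def)
    have "a < card S" using expand[OF \<open>S \<subseteq> U\<close>] S(1,3) by linarith
    show ?thesis
    proof (cases "m \<le> card S")
      case False
      have "r * n + (r + 1) * m + card S + card (nb U S) \<le> card U"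
        using False S card_U nm by (simp add: algebra_simps)
      then show ?thesis using hole_small[of S U] \<open>S \<subseteq> U\<close> \<open>U \<subseteq> V\<close> \<open>a < card S\<close> by simp
    next
      case True
      define W where "W = U - set xs"
      have "W \<subseteq> V" using \<open>U \<subseteq> V\<close> by (auto simp: W_def)
      have "card (set xs) \<le> n" using len[OF xs] card_length le_trans by blast
      then have "r * n + (r + 1) * a \<le> card W"
        using card_U diff_card_le_card_Diff[of "set xs" U] by (simp add: W_def)
      then obtain A where "multipartite_hole R r a m W A"
        using Suc.IH[of W a] fin bounded \<open>W \<subseteq> V\<close> m \<open>a \<le> m\<close> by blast
      then have "multipartite_hole R (Suc r) a m V (A(Suc r := S))"
        by (rule multipartite_hole_extend_large[OF _ \<open>symp R\<close> \<open>W \<subseteq> V\<close>])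
           (use S True \<open>S \<subseteq> U\<close> \<open>U \<subseteq> V\<close> in \<open>auto simp: W_def\<close>)
      then show ?thesis by blast
    qed
  qed
qed

section \<open>Janson's inequality\<close>

lemma finite_set_Pi_pmf_bernoulli:
  "finite E \<Longrightarrow> finite (set_pmf (Pi_pmf E False (\<lambda>_. bernoulli_pmf p)))"
  by (rule finite_subset[OF set_Pi_pmf_subset']) auto

locale random_subset =
  fixes E :: "'a set" and p :: real
  assumes finite_E: "finite E" and p: "0 \<le> p" "p \<le> 1"
begin

abbreviation Q where "Q \<equiv> Pi_pmf E False (\<lambda>_. bernoulli_pmf p)"

abbreviation \<E> :: "(('a \<Rightarrow> bool) \<Rightarrow> real) \<Rightarrow> real" where "\<E> \<equiv> measure_pmf.expectation Q"

lemma integrable_Q [simp]: "integrable Q (f :: _ \<Rightarrow> real)"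
  by (intro integrable_measure_pmf_finite finite_set_Pi_pmf_bernoulli finite_E)

text \<open>Split \<open>Q\<close> on the coordinate \<open>e\<close>: the value
  \<open>False\<close> contributes nothing, and \<open>D (f(e := True))\<close> does not depend on
  this coordinate.\<close>

lemma expectation_of_bool_edge:
  assumes "e \<in> E"
  shows "\<E> (\<lambda>f. of_bool (f e) * D f) = p * \<E> (\<lambda>f. D (f(e := True)))"
proof -
  define Q' where "Q' = Pi_pmf (E - {e}) False (\<lambda>_. bernoulli_pmf p)"
  have "finite (set_pmf Q')"
    unfolding Q'_def using finite_E by (intro finite_set_Pi_pmf_bernoulli) auto
  then have [simp]: "integrable Q' g" for g :: "_ \<Rightarrow> real"
    by (intro integrable_measure_pmf_finite)
  have Q: "Q = bernoulli_pmf p \<bind> (\<lambda>b. map_pmf (\<lambda>f. f(e := b)) Q')"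
    using Pi_pmf_insert'[of "E - {e}" e False "\<lambda>_. bernoulli_pmf p"] finite_E assms
    by (simp add: Q'_def insert_absorb map_pmf_def)
  have eq: "\<E> g = p * measure_pmf.expectation Q' (\<lambda>f. g (f(e := True)))
       + (1 - p) * measure_pmf.expectation Q' (\<lambda>f. g (f(e := False)))" for g :: "_ \<Rightarrow> real"
    unfolding Q using p \<open>finite (set_pmf Q')\<close>
    by (subst pmf_expectation_bind[where A = UNIV]) (auto simp: UNIV_bool)
  show ?thesis by (simp add: eq algebra_simps)
qed

lemma expectation_of_bool_edges:
  assumes "S \<subseteq> E"
  shows "\<E> (\<lambda>f. of_bool (\<forall>e\<in>S. f e) * D f) = p ^ card S * \<E> (\<lambda>f. D (\<lambda>e. e \<in> S \<or> f e))"
proof -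
  have "finite S" using assms finite_E finite_subset by blast
  then show ?thesis using assms
  proof (induction S arbitrary: D)
    case (insert e S)
    have "\<E> (\<lambda>f. of_bool (\<forall>x\<in>insert e S. f x) * D f) =
        \<E> (\<lambda>f. of_bool (f e) * (of_bool (\<forall>x\<in>S. f x) * D f))"
      by (intro arg_cong[of _ _ \<E>]) auto
    also have "\<dots> = p * \<E> (\<lambda>f. of_bool (\<forall>x\<in>S. (f(e := True)) x) * D (f(e := True)))"
      using insert.prems by (subst expectation_of_bool_edge) auto
    also have "\<E> (\<lambda>f. of_bool (\<forall>x\<in>S. (f(e := True)) x) * D (f(e := True))) =
        \<E> (\<lambda>f. of_bool (\<forall>x\<in>S. f x) * D (f(e := True)))"
      using insert.hyps by (intro arg_cong[of _ _ \<E>] ext arg_cong2[of _ _ _ _ "(*)"]) auto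
    also have "\<dots> = p ^ card S * \<E> (\<lambda>f. D ((\<lambda>x. x \<in> S \<or> f x)(e := True)))"
      using insert.prems by (subst insert.IH) auto
    also have "(\<lambda>f. D ((\<lambda>x. x \<in> S \<or> f x)(e := True))) = (\<lambda>f. D (\<lambda>x. x \<in> insert e S \<or> f x))"
      by (intro ext arg_cong[of _ _ D]) auto
    finally show ?case using insert.hyps by simp
  qed simp
qed

text \<open>Making all elements of \<open>S\<close> present can only decrease \<open>D\<close>. This
  is the Harris inequality for the increasing event that a fixed set occurs.\<close>

lemma expectation_of_bool_antimono:
  assumes "S \<subseteq> E" "antimono D"
  shows "\<E> (\<lambda>f. of_bool (\<forall>e\<in>S. f e) * D f) \<le> p ^ card S * \<E> D"
proof -
  have "\<E> (\<lambda>f. D (\<lambda>e. e \<in> S \<or> f e)) \<le> \<E> D"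
    by (intro integral_mono) (auto intro!: antimonoD[OF assms(2)] simp: le_fun_def)
  then show ?thesis
    using p by (simp add: expectation_of_bool_edges[OF assms(1)] mult_left_mono)
qed


text \<open>The Weierstrass product inequality, used below for the factors of the sets that meet a
  given one.\<close>

lemma one_minus_sum_le_prod:
  fixes x :: "'b \<Rightarrow> real"
  assumes "finite I" "\<And>i. i \<in> I \<Longrightarrow> 0 \<le> x i \<and> x i \<le> 1"
  shows "1 - sum x I \<le> (\<Prod>i\<in>I. 1 - x i)"
  using assms
proof (induction I)
  case (insert i I)
  define P where "P = (\<Prod>j\<in>I. 1 - x j)"
  have "P \<le> 1" unfolding P_def using insert.prems by (intro prod_le_1) auto
  then have "x i * P \<le> x i" using insert.prems by (simp add: mult_left_le)
  moreover have "1 - sum x I \<le> P" unfolding P_def using insert by auto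
  moreover have "(\<Prod>j\<in>insert i I. 1 - x j) = P - x i * P"
    using insert.hyps by (simp add: P_def left_diff_distrib)
  ultimately show ?case using insert.hyps by simp
qed simp

text \<open>The product damps each configuration by a factor \<open>1 - w\<close> per occurring set; this weighting
  replaces the random sparsification of the sets in the usual derivation of Janson's inequality
  from its version for small correlations.\<close>

lemma janson_weighted:
  fixes T :: "'b \<Rightarrow> 'a set"
  assumes "finite I" "\<And>i. i \<in> I \<Longrightarrow> T i \<subseteq> E" "0 \<le> w" "w \<le> 1"
  shows "\<E> (\<lambda>f. \<Prod>i\<in>I. 1 - w * of_bool (\<forall>e\<in>T i. f e)) \<le>
    exp (- w * (\<Sum>i\<in>I. p ^ card (T i)) +
         w\<^sup>2 * (\<Sum>i\<in>I. \<Sum>j\<in>{j\<in>I. T i \<inter> T j \<noteq> {}}. p ^ card (T i \<union> T j)))"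
  using assms(1,2)
proof (induction I)
  case (insert k I)
  define y where "y = (\<lambda>i f. of_bool (\<forall>e\<in>T i. f e) :: real)"
  \<comment> \<open>\<open>J\<close> collects the sets that meet \<open>T k\<close>. The product
    \<open>D\<close> over the others ignores the coordinates in \<open>T k\<close>, so it is
    independent of \<open>y k\<close>.\<close>
  define J where "J = {i\<in>I. T k \<inter> T i \<noteq> {}}"
  define D where "D = (\<lambda>f. \<Prod>i\<in>I - J. 1 - w * y i f)"
  define F where "F = (\<lambda>f. \<Prod>i\<in>I. 1 - w * y i f)"
  define \<delta> where "\<delta> = (\<Sum>j\<in>J. p ^ card (T k \<union> T j))"
  have fin: "finite I" "finite J" using insert.hyps by (auto simp: J_def)
  have y01: "0 \<le> y i f" "y i f \<le> 1" for i f by (auto simp: y_def)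
  have wy01: "0 \<le> w * y i f" "w * y i f \<le> 1" for i f
    using y01[of i f] assms(3,4) by (auto intro: mult_le_one)
  have F_split: "F f = (\<Prod>i\<in>J. 1 - w * y i f) * D f" for f
    unfolding F_def D_def using fin by (subst prod.subset_diff[of J I]) (auto simp: J_def)
  have D01: "0 \<le> D f" for f unfolding D_def using wy01 by (intro prod_nonneg) auto
  have F_nonneg: "0 \<le> F f" for f unfolding F_def using wy01 by (intro prod_nonneg) auto
  have "antimono D"
  proof (rule antimonoI)
    fix f g :: "'a \<Rightarrow> bool" assume "f \<le> g"
    then have "y i f \<le> y i g" for i by (auto simp: y_def le_fun_def)
    then show "D g \<le> D f" unfolding D_def using wy01 assms(3)
      by (intro prod_mono) (auto intro: mult_left_mono)
  qed
  have "F f \<le> D f" for f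
    using D01[of f] wy01 by (auto simp: F_split intro!: mult_left_le_one_le prod_nonneg prod_le_1)
  then have FD: "\<E> F \<le> \<E> D" by (intro integral_mono) auto
  have "\<E> (\<lambda>f. y k f * D f) = p ^ card (T k) * \<E> D"
  proof -
    have "D (\<lambda>e. e \<in> T k \<or> f e) = D f" for f
      unfolding D_def y_def J_def by (intro prod.cong refl) auto
    then show ?thesis
      unfolding y_def using insert.prems by (subst expectation_of_bool_edges) auto
  qed
  moreover have "\<E> (\<lambda>f. y k f * y j f * D f) \<le> p ^ card (T k \<union> T j) * \<E> D" if "j \<in> J" for j
  proof -
    have "y k f * y j f = of_bool (\<forall>e\<in>T k \<union> T j. f e)" for f by (auto simp: y_def)
    then show ?thesis
      using expectation_of_bool_antimono[of "T k \<union> T j" D] \<open>antimono D\<close> insert.prems that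
      by (auto simp: J_def)
  qed
  then have "(\<Sum>j\<in>J. \<E> (\<lambda>f. y k f * y j f * D f)) \<le> \<delta> * \<E> D"
    unfolding \<delta>_def sum_distrib_right by (rule sum_mono)
  moreover have "\<E> (\<lambda>f. y k f * D f) - w * (\<Sum>j\<in>J. \<E> (\<lambda>f. y k f * y j f * D f)) \<le> \<E> (\<lambda>f. y k f * F f)"
  proof -
    have "y k f * D f - w * (\<Sum>j\<in>J. y k f * y j f * D f) \<le> y k f * F f" for f
    proof -
      have "1 - (\<Sum>j\<in>J. w * y j f) \<le> (\<Prod>j\<in>J. 1 - w * y j f)"
        by (rule one_minus_sum_le_prod) (use wy01 fin in auto)
      then have "(y k f * D f) * (1 - (\<Sum>j\<in>J. w * y j f)) \<le> (y k f * D f) * (\<Prod>j\<in>J. 1 - w * y j f)"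
        using D01[of f] y01[of k f] by (intro mult_left_mono) auto
      then show ?thesis by (simp add: F_split algebra_simps sum_distrib_left)
    qed
    then have "\<E> (\<lambda>f. y k f * D f - w * (\<Sum>j\<in>J. y k f * y j f * D f)) \<le> \<E> (\<lambda>f. y k f * F f)"
      by (intro integral_mono) auto
    then show ?thesis by simp
  qed
  ultimately have low: "(p ^ card (T k) - w * \<delta>) * \<E> D \<le> \<E> (\<lambda>f. y k f * F f)"
    using mult_left_mono[of "(\<Sum>j\<in>J. \<E> (\<lambda>f. y k f * y j f * D f))" "\<delta> * \<E> D" w] assms(3)
    by (simp add: algebra_simps)
  have F0: "0 \<le> \<E> F" using F_nonneg by simp
  \<comment> \<open>\<open>\<E> D\<close> can be replaced by the smaller \<open>\<E> F\<close> if
    the factor is nonnegative; if it is negative, the left side is at most 0.\<close>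
  have low': "(p ^ card (T k) - w * \<delta>) * \<E> F \<le> \<E> (\<lambda>f. y k f * F f)"
  proof (cases "0 \<le> p ^ card (T k) - w * \<delta>")
    case True
    then show ?thesis using low mult_left_mono[OF FD True] by simp
  next
    case False
    then have "(p ^ card (T k) - w * \<delta>) * \<E> F \<le> 0" using F0 by (intro mult_nonpos_nonneg) auto
    also have "0 \<le> \<E> (\<lambda>f. y k f * F f)" using F_nonneg y01 by simp
    finally show ?thesis .
  qed
  define x where "x = p ^ card (T k) - w * \<delta>"
  have "\<E> (\<lambda>f. \<Prod>i\<in>insert k I. 1 - w * y i f) = \<E> F - w * \<E> (\<lambda>f. y k f * F f)"
    using insert.hyps by (simp add: F_def algebra_simps)
  also have "\<dots> \<le> (1 - w * x) * \<E> F"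
    using mult_left_mono[OF low'[folded x_def] assms(3)] by (simp add: algebra_simps)
  also have "\<dots> \<le> exp (- w * x) * \<E> F"
    using exp_ge_add_one_self[of "- w * x"] F0 by (intro mult_right_mono) auto
  also have "\<dots> \<le> exp (- w * x) * exp (- w * (\<Sum>i\<in>I. p ^ card (T i)) +
         w\<^sup>2 * (\<Sum>i\<in>I. \<Sum>j\<in>{j\<in>I. T i \<inter> T j \<noteq> {}}. p ^ card (T i \<union> T j)))"
    using insert unfolding F_def y_def by (intro mult_left_mono) auto
  also have "\<dots> = exp (- w * (\<Sum>i\<in>insert k I. p ^ card (T i)) +
         w\<^sup>2 * (\<delta> + (\<Sum>i\<in>I. \<Sum>j\<in>{j\<in>I. T i \<inter> T j \<noteq> {}}. p ^ card (T i \<union> T j))))"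
    using insert.hyps by (simp add: x_def power2_eq_square algebra_simps flip: exp_add)
  \<comment> \<open>The double sum runs over ordered pairs including the diagonal, so it grows by at
    least \<open>\<delta>\<close>.\<close>
  also have "\<dots> \<le> exp (- w * (\<Sum>i\<in>insert k I. p ^ card (T i)) +
         w\<^sup>2 * (\<Sum>i\<in>insert k I. \<Sum>j\<in>{j\<in>insert k I. T i \<inter> T j \<noteq> {}}. p ^ card (T i \<union> T j)))"
  proof -
    have "\<delta> \<le> (\<Sum>j\<in>{j\<in>insert k I. T k \<inter> T j \<noteq> {}}. p ^ card (T k \<union> T j))"
      unfolding \<delta>_def J_def using fin p by (intro sum_mono2) auto
    moreover have "(\<Sum>i\<in>I. \<Sum>j\<in>{j\<in>I. T i \<inter> T j \<noteq> {}}. p ^ card (T i \<union> T j)) \<le>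
        (\<Sum>i\<in>I. \<Sum>j\<in>{j\<in>insert k I. T i \<inter> T j \<noteq> {}}. p ^ card (T i \<union> T j))"
      using fin p by (intro sum_mono sum_mono2) auto
    ultimately show ?thesis using insert.hyps by (auto intro!: mult_left_mono)
  qed
  finally show ?case by (simp add: y_def)
qed simp

text \<open>Janson's bound with \<open>L\<close> at most \<open>\<mu>\<^sup>2 / \<Delta>\<close>,
  where \<open>\<Delta>\<close> sums over ordered pairs and includes the diagonal.\<close>

lemma janson:
  fixes T :: "'b \<Rightarrow> 'a set" and I
  assumes "finite I" "\<And>i. i \<in> I \<Longrightarrow> T i \<subseteq> E \<and> T i \<noteq> {}"
  defines "\<mu> \<equiv> \<Sum>i\<in>I. p ^ card (T i)"
    and "\<Delta> \<equiv> \<Sum>i\<in>I. \<Sum>j\<in>{j\<in>I. T i \<inter> T j \<noteq> {}}. p ^ card (T i \<union> T j)"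
  assumes "L > 0" "L * \<Delta> \<le> \<mu>\<^sup>2" "\<mu> > 0"
  shows "measure_pmf.prob Q {f. \<forall>i\<in>I. \<exists>e\<in>T i. \<not> f e} \<le> exp (- L / 4)"
proof -
  have "\<mu> \<le> \<Delta>" unfolding \<mu>_def \<Delta>_def
  proof (rule sum_mono)
    fix i assume i: "i \<in> I"
    then have "p ^ card (T i) = (\<Sum>j\<in>{i}. p ^ card (T i \<union> T j))" by simp
    also have "\<dots> \<le> (\<Sum>j\<in>{j\<in>I. T i \<inter> T j \<noteq> {}}. p ^ card (T i \<union> T j))"
      using i assms(1,2) p by (intro sum_mono2) auto
    finally show "p ^ card (T i) \<le> (\<Sum>j\<in>{j\<in>I. T i \<inter> T j \<noteq> {}}. p ^ card (T i \<union> T j))" .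
  qed
  with \<open>\<mu> > 0\<close> have "\<Delta> > 0" "0 \<le> \<mu>" by auto
  \<comment> \<open>This value minimises \<open>- w * \<mu> + w\<^sup>2 * \<Delta>\<close>; it is at
    most 1 because the diagonal terms give \<open>\<mu> \<le> \<Delta>\<close>.\<close>
  define w where "w = \<mu> / (2 * \<Delta>)"
  have w: "0 \<le> w" "w \<le> 1" using \<open>\<mu> \<le> \<Delta>\<close> \<open>0 \<le> \<mu>\<close> \<open>\<Delta> > 0\<close> by (auto simp: w_def field_simps)
  have "measure_pmf.prob Q {f. \<forall>i\<in>I. \<exists>e\<in>T i. \<not> f e} = \<E> (indicator {f. \<forall>i\<in>I. \<exists>e\<in>T i. \<not> f e})"
    by simp
  \<comment> \<open>If no \<open>T i\<close> occurs, all factors are 1; otherwise the product is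
    still nonnegative.\<close>
  also have "\<dots> \<le> \<E> (\<lambda>f. \<Prod>i\<in>I. 1 - w * of_bool (\<forall>e\<in>T i. f e))"
  proof (intro integral_mono)
    fix f :: "'a \<Rightarrow> bool"
    have "(\<Prod>i\<in>I. 1 - w * of_bool (\<forall>e\<in>T i. f e)) = 1" if "\<forall>i\<in>I. \<exists>e\<in>T i. \<not> f e"
      using that by (intro prod.neutral) auto
    moreover have "0 \<le> (\<Prod>i\<in>I. 1 - w * of_bool (\<forall>e\<in>T i. f e))"
      using w by (intro prod_nonneg) auto
    ultimately show "indicator {f. \<forall>i\<in>I. \<exists>e\<in>T i. \<not> f e} f \<le> (\<Prod>i\<in>I. 1 - w * of_bool (\<forall>e\<in>T i. f e))"
      by (auto simp: indicator_def)
  qed auto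
  also have "\<dots> \<le> exp (- w * \<mu> + w\<^sup>2 * \<Delta>)"
    unfolding \<mu>_def \<Delta>_def using assms(1,2) w by (intro janson_weighted) auto
  also have "- w * \<mu> + w\<^sup>2 * \<Delta> = - (\<mu>\<^sup>2 / \<Delta>) / 4"
    using \<open>\<Delta> > 0\<close> by (simp add: w_def power2_eq_square field_simps)
  also have "\<dots> \<le> - L / 4" using assms(6) \<open>\<Delta> > 0\<close> by (simp add: pos_le_divide_eq)
  finally show ?thesis by simp
qed

end

section \<open>Transversal cliques\<close>

text \<open>In Janson's inequality, the pairs that agree exactly on \<open>J\<close> contribute at
  most \<open>\<mu>\<^sup>2 / L\<close> to \<open>\<Delta>\<close>, because \<open>L\<close> bounds
  the expected number of cliques on the parts in \<open>J\<close> from below. The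
  \<open>2 ^ (r + 1)\<close> choices of \<open>J\<close> and the 4 in Janson's exponent give
  \<open>2 ^ (r + 3)\<close>.\<close>

lemma prob_no_transversal_clique:
  fixes A :: "nat \<Rightarrow> 'a set"
  assumes "finite V" "0 < p" "p \<le> 1" "1 \<le> r" "\<And>i. i \<le> r \<Longrightarrow> A i \<subseteq> V" "disjoint_family_on A {..r}"
    and "0 < L"
    and L: "\<And>J. J \<subseteq> {..r} \<Longrightarrow> 2 \<le> card J \<Longrightarrow> L \<le> (\<Prod>i\<in>J. real (card (A i))) * p ^ (card J choose 2)"
  shows "measure_pmf.prob (Pi_pmf (nsets V 2) False (\<lambda>_. bernoulli_pmf p))
      {f. \<forall>\<phi>\<in>PiE {..r} A. \<exists>e\<in>nsets (\<phi> ` {..r}) 2. \<not> f e} \<le> exp (- L / 2 ^ (r + 3))"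
proof -
  interpret random_subset "nsets V 2" p
    using assms by unfold_locales (auto simp: finite_imp_finite_nsets)
  define I where "I = PiE {..r} A"
  define T where "T = (\<lambda>\<phi> :: nat \<Rightarrow> 'a. nsets (\<phi> ` {..r}) 2)"
  define M where "M = (Suc r choose 2)"
  define P where "P = (\<Prod>i\<le>r. real (card (A i)))"
  define common where "common = (\<lambda>\<phi> \<psi> :: nat \<Rightarrow> 'a. {i. i \<le> r \<and> \<phi> i = \<psi> i})"
  have fin_A: "finite (A i)" if "i \<le> r" for i
    using that assms finite_subset by blast
  have "finite I" unfolding I_def using fin_A by (intro finite_PiE) auto
  have card_I: "real (card I) = P"
    unfolding I_def P_def by (subst card_PiE) auto
  \<comment> \<open>As the parts are disjoint, a vertex shared by two transversals has the same
    index in both. Hence their cliques share exactly the edges on the indices in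
    \<open>common\<close>.\<close>
  have same: "i = j" if "\<phi> \<in> I" "\<psi> \<in> I" "i \<le> r" "j \<le> r" "\<phi> i = \<psi> j" for \<phi> \<psi> i j
  proof (rule ccontr)
    assume "i \<noteq> j"
    then have "A i \<inter> A j = {}" using assms(6) that by (auto simp: disjoint_family_on_def)
    moreover have "\<phi> i \<in> A i" "\<psi> j \<in> A j" using that(1-4) by (auto simp: I_def)
    ultimately show False using that by auto
  qed
  then have inj: "inj_on \<phi> {..r}" if "\<phi> \<in> I" for \<phi> using that by (auto intro!: inj_onI)
  have card_T: "card (T \<phi>) = M" if "\<phi> \<in> I" for \<phi>
    using inj[OF that] by (simp add: T_def card_nsets card_image M_def)
  have T_Int: "T \<phi> \<inter> T \<psi> = nsets (\<phi> ` common \<phi> \<psi>) 2" if "\<phi> \<in> I" "\<psi> \<in> I" for \<phi> \<psi>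
  proof -
    have "\<phi> ` {..r} \<inter> \<psi> ` {..r} = \<phi> ` common \<phi> \<psi>"
      using same[OF that] by (force simp: common_def)
    moreover have "T \<phi> \<inter> T \<psi> = nsets (\<phi> ` {..r} \<inter> \<psi> ` {..r}) 2" by (auto simp: T_def nsets_def)
    ultimately show ?thesis by simp
  qed
  have card_T_Int: "card (T \<phi> \<inter> T \<psi>) = (card (common \<phi> \<psi>) choose 2)" if "\<phi> \<in> I" "\<psi> \<in> I" for \<phi> \<psi>
  proof -
    have "inj_on \<phi> (common \<phi> \<psi>)" by (rule inj_on_subset[OF inj[OF that(1)]]) (auto simp: common_def)
    moreover have "finite (common \<phi> \<psi>)" by (auto simp: common_def)
    ultimately show ?thesis using T_Int[OF that] by (simp add: card_nsets card_image)
  qed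
  have card_T_Un: "card (T \<phi> \<union> T \<psi>) + (card (common \<phi> \<psi>) choose 2) = 2 * M"
    if "\<phi> \<in> I" "\<psi> \<in> I" for \<phi> \<psi>
    using card_Un_Int[of "T \<phi>" "T \<psi>"] card_T that card_T_Int
    by (simp add: T_def finite_imp_finite_nsets)
  have inner: "L * (\<Sum>\<psi>\<in>{\<psi>\<in>I. T \<phi> \<inter> T \<psi> \<noteq> {}}. p ^ card (T \<phi> \<union> T \<psi>)) \<le> 2 ^ (r + 1) * (P * p ^ (2 * M))"
    if "\<phi> \<in> I" for \<phi>
  proof -
    define S where "S = {\<psi>\<in>I. T \<phi> \<inter> T \<psi> \<noteq> {}}"
    have "finite S" using \<open>finite I\<close> by (simp add: S_def)
    have block: "L * (\<Sum>\<psi>\<in>{\<psi>\<in>S. common \<phi> \<psi> = J}. p ^ card (T \<phi> \<union> T \<psi>)) \<le> P * p ^ (2 * M)"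
      if J: "J \<subseteq> {..r}" for J
    proof (cases "2 \<le> card J")
      case True
      define S' where "S' = {\<psi>\<in>S. common \<phi> \<psi> = J}"
      define B where "B = (\<Prod>i\<in>J. real (card (A i)))"
      \<comment> \<open>Pinning \<open>\<psi>\<close> to \<open>\<phi>\<close> on \<open>J\<close>
        leaves \<open>P / B\<close> choices.\<close>
      define D where "D = PiE {..r} (\<lambda>i. if i \<in> J then {\<phi> i} else A i)"
      have "S' \<subseteq> D" by (auto simp: S'_def S_def D_def I_def common_def PiE_iff extensional_def split: if_splits)
      moreover have "finite D" unfolding D_def using fin_A by (intro finite_PiE) auto
      ultimately have "card S' \<le> card D" by (rule card_mono[rotated])
      moreover have "real (card D) * B = P"
      proof -
        have "real (card D) = (\<Prod>i\<le>r. if i \<in> J then 1 else real (card (A i)))"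
          unfolding D_def by (subst card_PiE) (auto intro!: prod.cong)
        moreover have "B = (\<Prod>i\<le>r. if i \<in> J then real (card (A i)) else 1)"
          using J unfolding B_def by (subst prod.inter_restrict[symmetric]) (auto simp: Int_absorb1)
        ultimately show ?thesis
          by (simp add: P_def prod.distrib[symmetric] if_distrib cong: if_cong)
      qed
      moreover have "B \<ge> 0" by (auto simp: B_def intro: prod_nonneg)
      ultimately have "real (card S') * B \<le> P"
        using mult_right_mono[of "real (card S')" "real (card D)" B] by simp
      have "L * p ^ card (T \<phi> \<union> T \<psi>) \<le> B * p ^ (2 * M)" if "\<psi> \<in> S'" for \<psi>
      proof -
        have \<psi>: "\<psi> \<in> I" "common \<phi> \<psi> = J" using that by (auto simp: S'_def S_def)
        have "L * p ^ card (T \<phi> \<union> T \<psi>) \<le> B * p ^ (card J choose 2) * p ^ card (T \<phi> \<union> T \<psi>)"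
          using L[OF J True] assms(2) by (intro mult_right_mono) (auto simp: B_def)
        also have "\<dots> = B * p ^ (card (T \<phi> \<union> T \<psi>) + (card J choose 2))"
          by (simp add: power_add)
        also have "\<dots> = B * p ^ (2 * M)"
          using card_T_Un[OF \<open>\<phi> \<in> I\<close> \<psi>(1)] \<psi>(2) by simp
        finally show ?thesis .
      qed
      then have "(\<Sum>\<psi>\<in>S'. L * p ^ card (T \<phi> \<union> T \<psi>)) \<le> (\<Sum>\<psi>\<in>S'. B * p ^ (2 * M))"
        by (rule sum_mono)
      also have "\<dots> = (real (card S') * B) * p ^ (2 * M)" by simp
      also have "\<dots> \<le> P * p ^ (2 * M)"
        using \<open>real (card S') * B \<le> P\<close> assms(2) by (intro mult_right_mono) auto
      finally show ?thesis by (simp add: S'_def sum_distrib_left)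
    next
      case False
      \<comment> \<open>Sharing an edge requires agreement on at least two indices.\<close>
      have empty: "{\<psi>\<in>S. common \<phi> \<psi> = J} = {}"
      proof (rule ccontr)
        assume "{\<psi>\<in>S. common \<phi> \<psi> = J} \<noteq> {}"
        then obtain \<psi> where "\<psi> \<in> I" "T \<phi> \<inter> T \<psi> \<noteq> {}" "common \<phi> \<psi> = J" by (auto simp: S_def)
        moreover from this have "card (T \<phi> \<inter> T \<psi>) \<noteq> 0"
          by (simp add: T_def finite_imp_finite_nsets)
        ultimately have "(card J choose 2) \<noteq> 0"
          using card_T_Int[OF \<open>\<phi> \<in> I\<close>, of \<psi>] by simp
        then show False using False by (simp add: binomial_eq_0)
      qed
      moreover have "0 \<le> P" by (auto simp: P_def intro: prod_nonneg)
      ultimately show ?thesis unfolding empty using assms(2) by simp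
    qed
    have "(\<Sum>\<psi>\<in>S. p ^ card (T \<phi> \<union> T \<psi>)) =
        (\<Sum>J\<in>Pow {..r}. \<Sum>\<psi>\<in>{\<psi>\<in>S. common \<phi> \<psi> = J}. p ^ card (T \<phi> \<union> T \<psi>))"
      using \<open>finite S\<close> by (intro sum.group[symmetric]) (auto simp: common_def)
    then have "L * (\<Sum>\<psi>\<in>S. p ^ card (T \<phi> \<union> T \<psi>)) =
        (\<Sum>J\<in>Pow {..r}. L * (\<Sum>\<psi>\<in>{\<psi>\<in>S. common \<phi> \<psi> = J}. p ^ card (T \<phi> \<union> T \<psi>)))"
      by (simp add: sum_distrib_left)
    also have "\<dots> \<le> (\<Sum>J\<in>Pow {..r}. P * p ^ (2 * M))" by (intro sum_mono block) auto
    also have "\<dots> = 2 ^ (r + 1) * (P * p ^ (2 * M))" by (simp add: card_Pow)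
    finally show ?thesis by (simp add: S_def)
  qed
  define \<mu> where "\<mu> = (\<Sum>\<phi>\<in>I. p ^ card (T \<phi>))"
  define \<Delta> where "\<Delta> = (\<Sum>\<phi>\<in>I. \<Sum>\<psi>\<in>{\<psi>\<in>I. T \<phi> \<inter> T \<psi> \<noteq> {}}. p ^ card (T \<phi> \<union> T \<psi>))"
  have \<mu>: "\<mu> = P * p ^ M" using card_T card_I by (simp add: \<mu>_def)
  have "0 < P * p ^ (Suc r choose 2)"
    using L[of "{..r}"] assms(4,7) by (auto simp: P_def)
  then have "0 < \<mu>" by (simp add: \<mu> M_def)
  have "L * \<Delta> \<le> (\<Sum>\<phi>\<in>I. 2 ^ (r + 1) * (P * p ^ (2 * M)))"
    unfolding \<Delta>_def sum_distrib_left[of L _ I] by (intro sum_mono inner)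
  also have "\<dots> = 2 ^ (r + 1) * \<mu>\<^sup>2"
  proof -
    have "p ^ (2 * M) = p ^ M * p ^ M" by (simp only: mult_2 power_add)
    then show ?thesis by (simp add: card_I \<mu> power2_eq_square)
  qed
  finally have "L / 2 ^ (r + 1) * \<Delta> \<le> \<mu>\<^sup>2"
    by (simp add: pos_divide_le_eq mult.commute)
  moreover have "T \<phi> \<subseteq> nsets V 2 \<and> T \<phi> \<noteq> {}" if "\<phi> \<in> I" for \<phi>
  proof
    have "\<phi> ` {..r} \<subseteq> V" using that assms(5) by (auto simp: I_def)
    then show "T \<phi> \<subseteq> nsets V 2" unfolding T_def by (rule nsets_mono)
    have "M > 0" using assms(4) by (simp add: M_def zero_less_binomial)
    then show "T \<phi> \<noteq> {}" using card_T[OF that] by auto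
  qed
  ultimately have "measure_pmf.prob Q {f. \<forall>\<phi>\<in>I. \<exists>e\<in>T \<phi>. \<not> f e} \<le> exp (- (L / 2 ^ (r + 1)) / 4)"
    using \<open>finite I\<close> \<open>0 < \<mu>\<close> \<open>0 < L\<close> unfolding \<mu>_def \<Delta>_def by (intro janson) auto
  also have "- (L / 2 ^ (r + 1)) / 4 = - L / 2 ^ (r + 3)" by (simp add: power_add)
  finally show ?thesis by (simp only: I_def T_def)
qed

text \<open>For \<open>card J = l + 2\<close> the product of the sizes is at least
  \<open>a * m ^ (l + 1)\<close>. Setting aside \<open>a * p * m\<close> leaves
  \<open>m ^ l * p ^ j\<close> with \<open>2 * j = l * (l + 3)\<close>. Its square is
  \<open>(m\<^sup>2 * p ^ (l + 3)) ^ l\<close>, which is at least 1 as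
  \<open>l + 3 \<le> r + 2\<close>.\<close>

lemma transversal_expectation_bound:
  fixes A :: "nat \<Rightarrow> 'a set" and p c :: real
  assumes p: "0 < p" "p \<le> 1" and "0 \<le> c" "c \<le> real a * p" "a \<le> m" "1 \<le> (real m)\<^sup>2 * p ^ (r + 2)"
    and "a \<le> card (A 0)" "\<And>i. 1 \<le> i \<Longrightarrow> i \<le> r \<Longrightarrow> m \<le> card (A i)"
    and "J \<subseteq> {..r}" "2 \<le> card J"
  shows "c * real m \<le> (\<Prod>i\<in>J. real (card (A i))) * p ^ (card J choose 2)"
proof -
  obtain l where l: "card J = Suc (Suc l)" using \<open>2 \<le> card J\<close> by (metis add_2_eq_Suc le_Suc_ex)
  have "finite J" using \<open>J \<subseteq> {..r}\<close> finite_subset by blast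
  have "card J \<le> Suc r" using card_mono[OF _ \<open>J \<subseteq> {..r}\<close>] by simp
  then have "l + 3 \<le> r + 2" using l by simp
  have pow: "real m ^ card J' \<le> (\<Prod>i\<in>J'. real (card (A i)))" if "J' \<subseteq> {1..r}" for J'
  proof -
    have "(\<Prod>i\<in>J'. real m) \<le> (\<Prod>i\<in>J'. real (card (A i)))"
      using that assms(8) by (intro prod_mono) (auto simp: subset_iff)
    then show ?thesis by simp
  qed
  have "real a * real m ^ Suc l \<le> (\<Prod>i\<in>J. real (card (A i)))"
  proof (cases "0 \<in> J")
    case True
    have "J - {0} \<subseteq> {1..r}" using \<open>J \<subseteq> {..r}\<close> by (auto simp: Suc_le_eq)
    then have "real m ^ Suc l \<le> (\<Prod>i\<in>J - {0}. real (card (A i)))"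
      using pow[of "J - {0}"] l True \<open>finite J\<close> by simp
    then show ?thesis
      using assms(7) True \<open>finite J\<close> by (subst prod.remove[of J 0]) (auto intro!: mult_mono)
  next
    case False
    then have "J \<subseteq> {1..r}" using \<open>J \<subseteq> {..r}\<close> by (auto simp: Suc_le_eq subset_iff intro: gr0I)
    then have "real m ^ Suc (Suc l) \<le> (\<Prod>i\<in>J. real (card (A i)))" using pow[of J] l by simp
    moreover have "real a * real m ^ Suc l \<le> real m * real m ^ Suc l"
      using \<open>a \<le> m\<close> by (intro mult_right_mono) auto
    ultimately show ?thesis by simp
  qed
  define j where "j = (card J choose 2) - 1"
  have "card J choose 2 = Suc l + (Suc l choose 2)" by (simp add: l numeral_2_eq_2)
  then have j: "card J choose 2 = Suc j" by (simp add: j_def)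
  have "2 * Suc j = Suc (Suc l) * Suc l"
    using j l Suc_times_binomial_eq[of "Suc l" 1] by (simp add: numeral_2_eq_2)
  then have "2 * j = l * (l + 3)" by (simp add: algebra_simps)
  have "1 \<le> (real m)\<^sup>2 * p ^ (l + 3)"
    using assms(6) power_decreasing[OF \<open>l + 3 \<le> r + 2\<close>, of p] p
    by (meson less_imp_le mult_left_mono order_trans zero_le_power2)
  then have "1 \<le> ((real m)\<^sup>2 * p ^ (l + 3)) ^ l" by simp
  also have "\<dots> = (real m ^ l * p ^ j)\<^sup>2"
    using \<open>2 * j = l * (l + 3)\<close>
    by (simp add: power_mult_distrib mult.commute flip: power_mult)
  finally have "1 \<le> real m ^ l * p ^ j"
    using p abs_le_square_iff[of 1 "real m ^ l * p ^ j"] by (simp add: abs_mult)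
  then have "c * real m \<le> c * real m * (real m ^ l * p ^ j)"
    using \<open>0 \<le> c\<close> mult_left_mono[of 1 "real m ^ l * p ^ j" "c * real m"] by simp
  also have "\<dots> \<le> (real a * p) * real m * (real m ^ l * p ^ j)"
    using assms(4) p by (intro mult_right_mono) auto
  also have "\<dots> = real a * real m ^ Suc l * p ^ (card J choose 2)" by (simp add: j)
  also have "\<dots> \<le> (\<Prod>i\<in>J. real (card (A i))) * p ^ (card J choose 2)"
    using \<open>real a * real m ^ Suc l \<le> _\<close> p by (intro mult_right_mono) auto
  finally show ?thesis .
qed

section \<open>The Ramsey property\<close>

lemma contains_copy_path_ugraph:
  assumes "distinct xs" "successively (\<lambda>x y. {x, y} \<in> edges G) xs" "set xs \<subseteq> verts G" "n < length xs"
  shows "contains_copy G (path_ugraph n)"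
  unfolding contains_copy_def
proof (intro exI[of _ "\<lambda>i. xs ! i"] conjI)
  show "inj_on ((!) xs) (verts (path_ugraph n))"
    using assms(1,4) by (auto simp: path_ugraph_def inj_on_def nth_eq_iff_index_eq)
  show "(!) xs ` verts (path_ugraph n) \<subseteq> verts G"
    using assms(3,4) by (auto simp: path_ugraph_def subset_iff)
  have "{xs ! i, xs ! Suc i} \<in> edges G" if "i < n" for i
    using assms(2,4) that by (auto simp: successively_conv_nth)
  then show "\<forall>e\<in>edges (path_ugraph n). (!) xs ` e \<in> edges G"
    by (auto simp: path_ugraph_def)
qed

section \<open>Union bound over the possible holes\<close>

text \<open>The conditions on a hole that do not mention the colouring, so that a union bound can
  range over a fixed family. For finite \<open>V\<close>, \<open>PiE\<close> makes it
  finite.\<close>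

definition candidate_parts :: "nat \<Rightarrow> nat \<Rightarrow> nat \<Rightarrow> 'a set \<Rightarrow> (nat \<Rightarrow> 'a set) set" where
  "candidate_parts r a m V = {A \<in> PiE {..r} (\<lambda>_. Pow V). disjoint_family_on A {..r} \<and>
     a \<le> card (A 0) \<and> (\<forall>i\<in>{1..r}. m \<le> card (A i))}"

lemma candidate_parts_finite_card:
  assumes "finite V"
  shows "finite (candidate_parts r a m V) \<and> card (candidate_parts r a m V) \<le> 2 ^ (card V * (r + 1))"
proof -
  have sub: "candidate_parts r a m V \<subseteq> PiE {..r} (\<lambda>_. Pow V)" by (auto simp: candidate_parts_def)
  have fin: "finite (PiE {..r} (\<lambda>_. Pow V))" using assms by (intro finite_PiE) auto
  have "card (PiE {..r} (\<lambda>_. Pow V)) = 2 ^ (card V * (r + 1))"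
    using assms by (simp add: card_PiE card_Pow power_add power_mult)
  with sub fin show ?thesis by (metis card_mono finite_subset)
qed

text \<open>The deterministic part: without a blue path, the blue graph on \<open>V\<close> has a
  hole, and the given clique across it is entirely red.\<close>

lemma ramsey_arrow_if_transversal_cliques:
  fixes N :: nat
  assumes "V \<subseteq> {..<N}" "a \<le> m" "(r + 6) * m \<le> n" "r * n + (r + 1) * a \<le> card V"
    and cliques: "\<And>A. A \<in> candidate_parts r a m V \<Longrightarrow> \<exists>\<phi>\<in>PiE {..r} A. \<forall>e\<in>nsets (\<phi> ` {..r}) 2. f e"
  shows "ramsey_arrow \<lparr>verts = {..<N}, edges = {e \<in> nsets {..<N} 2. f e}\<rparr>
    (complete_ugraph (r + 1)) (path_ugraph n)"
  unfolding ramsey_arrow_def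
proof (rule allI, rule disjCI)
  fix \<kappa>
  define G where "G = \<lparr>verts = {..<N}, edges = {e \<in> nsets {..<N} 2. f e}\<rparr>"
  define R where "R = (\<lambda>x y. {x, y} \<in> edges (colour_class G \<kappa> Blue))"
  assume "\<not> contains_copy (colour_class \<lparr>verts = {..<N}, edges = {e \<in> nsets {..<N} 2. f e}\<rparr> \<kappa> Blue) (path_ugraph n)"
  then have "path_bounded R V n"
    using contains_copy_path_ugraph[of _ "colour_class G \<kappa> Blue" n] assms(1)
    unfolding path_bounded_def R_def G_def[symmetric]
    by (force simp: colour_class_def G_def not_le[symmetric])
  moreover have "symp R" by (auto simp: symp_def R_def insert_commute)
  moreover have "finite V" using finite_subset[OF assms(1)] by simp
  ultimately obtain A where A: "multipartite_hole R r a m V A"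
    using exists_multipartite_hole[of R V n a m r] assms(2-4) by blast
  then have "restrict A {..r} \<in> candidate_parts r a m V"
    by (auto simp: multipartite_hole_def candidate_parts_def disjoint_family_on_def)
  then obtain \<phi> where \<phi>: "\<And>i. i \<le> r \<Longrightarrow> \<phi> i \<in> A i" "\<And>e. e \<in> nsets (\<phi> ` {..r}) 2 \<Longrightarrow> f e"
    using cliques[of "restrict A {..r}"] by (fastforce simp: PiE_iff)
  have sub: "\<phi> i < N" if "i \<le> r" for i
    using \<phi>(1)[OF that] A assms(1) that by (auto simp: multipartite_hole_def)
  have neq: "\<phi> i \<noteq> \<phi> j" if "i \<le> r" "j \<le> r" "i \<noteq> j" for i j
  proof -
    have "A i \<inter> A j = {}"
      using A that by (simp add: multipartite_hole_def disjoint_family_on_def)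
    then show ?thesis using \<phi>(1)[OF that(1)] \<phi>(1)[OF that(2)] by auto
  qed
  have red: "{\<phi> i, \<phi> j} \<in> edges (colour_class G \<kappa> Red)" if "i \<le> r" "j \<le> r" "i \<noteq> j" for i j
  proof -
    have "\<not> R (\<phi> i) (\<phi> j)" using A \<phi>(1) that by (auto simp: multipartite_hole_def)
    moreover have "{\<phi> i, \<phi> j} \<in> edges G"
      using sub neq[OF that] that \<phi>(2)[of "{\<phi> i, \<phi> j}"] by (auto simp: G_def)
    ultimately show ?thesis by (auto simp: R_def colour_class_def intro: colour.exhaust)
  qed
  have "contains_copy (colour_class G \<kappa> Red) (complete_ugraph (r + 1))"
    unfolding contains_copy_def
  proof (intro exI[of _ \<phi>] conjI ballI)
    show "inj_on \<phi> (verts (complete_ugraph (r + 1)))"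
      by (rule inj_onI, rule ccontr) (use neq in \<open>auto simp: complete_ugraph_def less_Suc_eq_le\<close>)
    show "\<phi> ` verts (complete_ugraph (r + 1)) \<subseteq> verts (colour_class G \<kappa> Red)"
      using sub by (auto simp: complete_ugraph_def colour_class_def G_def)
    fix e assume "e \<in> edges (complete_ugraph (r + 1))"
    then obtain i j where "e = {i, j}" "i \<le> r" "j \<le> r" "i \<noteq> j"
      by (fastforce simp: complete_ugraph_def less_Suc_eq_le elim!: nsets2_E)
    then show "\<phi> ` e \<in> edges (colour_class G \<kappa> Red)" using red by auto
  qed
  then show "contains_copy (colour_class \<lparr>verts = {..<N}, edges = {e \<in> nsets {..<N} 2. f e}\<rparr> \<kappa> Red)
      (complete_ugraph (r + 1))" by (simp add: G_def)
qed

text \<open>A union bound over the candidate parts inside an initial segment of just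
  \<open>r * n + (r + 1) * a\<close> vertices. On all \<open>N\<close> vertices the number of
  candidates could outgrow the exponential gain, as \<open>N\<close> may be arbitrarily
  large.\<close>

lemma prob_ramsey_arrow_ge:
  fixes p c :: real
  assumes "1 \<le> r" "0 < p" "p \<le> 1" "0 < c" "c \<le> real a * p" "1 \<le> a" "a \<le> m"
    "1 \<le> (real m)\<^sup>2 * p ^ (r + 2)" "(r + 6) * m \<le> n" "r * n + (r + 1) * a \<le> N"
  shows "1 - 2 ^ ((r * n + (r + 1) * a) * (r + 1)) * exp (- (c * real m) / 2 ^ (r + 3)) \<le>
    measure_pmf.prob (random_graph N p)
      {G. ramsey_arrow G (complete_ugraph (r + 1)) (path_ugraph n)}"
proof -
  define K where "K = r * n + (r + 1) * a"
  define V where "V = {..<K}"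
  define Q where "Q = Pi_pmf (nsets {..<N} 2) False (\<lambda>_. bernoulli_pmf p)"
  define graph_of where "graph_of = (\<lambda>f. \<lparr>verts = {..<N}, edges = {e \<in> nsets {..<N} 2. f e}\<rparr>)"
  define bad where "bad = (\<lambda>A :: nat \<Rightarrow> nat set. {f. \<forall>\<phi>\<in>PiE {..r} A. \<exists>e\<in>nsets (\<phi> ` {..r}) 2. \<not> f e})"
  define \<A> where "\<A> = candidate_parts r a m V"
  have \<A>: "finite \<A>" "card \<A> \<le> 2 ^ (K * (r + 1))"
    using candidate_parts_finite_card[of V r a m] by (auto simp: \<A>_def V_def)
  have V: "V \<subseteq> {..<N}" "card V = K" using assms(10) by (auto simp: V_def K_def)
  have bad: "measure_pmf.prob Q (bad A) \<le> exp (- (c * real m) / 2 ^ (r + 3))" if "A \<in> \<A>" for A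
    unfolding Q_def bad_def
  proof (rule prob_no_transversal_clique)
    show "disjoint_family_on A {..r}" "\<And>i. i \<le> r \<Longrightarrow> A i \<subseteq> {..<N}"
      using that V by (auto simp: \<A>_def candidate_parts_def PiE_iff)
    show "0 < c * real m" using assms by simp
    show "c * real m \<le> (\<Prod>i\<in>J. real (card (A i))) * p ^ (card J choose 2)"
      if "J \<subseteq> {..r}" "2 \<le> card J" for J
      by (rule transversal_expectation_bound[where a = a and r = r])
         (use assms that \<open>A \<in> \<A>\<close> in \<open>auto simp: \<A>_def candidate_parts_def\<close>)
  qed (use assms in auto)
  have "- (graph_of -` {G. ramsey_arrow G (complete_ugraph (r + 1)) (path_ugraph n)}) \<subseteq> (\<Union>A\<in>\<A>. bad A)"
  proof (rule subsetI, rule ccontr)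
    fix f assume f: "f \<in> - (graph_of -` {G. ramsey_arrow G (complete_ugraph (r + 1)) (path_ugraph n)})"
      and "f \<notin> (\<Union>A\<in>\<A>. bad A)"
    then have "ramsey_arrow (graph_of f) (complete_ugraph (r + 1)) (path_ugraph n)"
      unfolding graph_of_def using assms V
      by (intro ramsey_arrow_if_transversal_cliques[of V]) (auto simp: \<A>_def bad_def K_def)
    with f show False by simp
  qed
  then have "measure_pmf.prob Q (- (graph_of -` {G. ramsey_arrow G (complete_ugraph (r + 1)) (path_ugraph n)}))
      \<le> measure_pmf.prob Q (\<Union>A\<in>\<A>. bad A)"
    by (intro measure_pmf.finite_measure_mono) auto
  also have "\<dots> \<le> (\<Sum>A\<in>\<A>. measure_pmf.prob Q (bad A))"
    using \<A> by (intro measure_pmf.finite_measure_subadditive_finite) auto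
  also have "\<dots> \<le> (\<Sum>A\<in>\<A>. exp (- (c * real m) / 2 ^ (r + 3)))" by (intro sum_mono bad)
  also have "\<dots> = real (card \<A>) * exp (- (c * real m) / 2 ^ (r + 3))" by simp
  also have "real (card \<A>) \<le> 2 ^ (K * (r + 1))"
    using \<A>(2) by (metis of_nat_le_iff of_nat_numeral of_nat_power)
  finally have "measure_pmf.prob Q (- (graph_of -` {G. ramsey_arrow G (complete_ugraph (r + 1)) (path_ugraph n)}))
      \<le> 2 ^ (K * (r + 1)) * exp (- (c * real m) / 2 ^ (r + 3))"
    by (simp add: mult_right_mono)
  moreover have "random_graph N p = map_pmf graph_of Q"
    by (simp add: random_graph_def graph_of_def Q_def)
  ultimately show ?thesis
    using measure_pmf.prob_compl[of "graph_of -` {G. ramsey_arrow G (complete_ugraph (r + 1)) (path_ugraph n)}" Q]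
    by (simp add: K_def Compl_eq_Diff_UNIV)
qed

section \<open>Asymptotics and choice of constants\<close>

text \<open>For \<open>n \<ge> 1\<close> the right side is the power with exponent
  \<open>r + 2\<close> of the ratio that tends to infinity, and
  \<open>B \<le> B ^ (r + 2)\<close>.\<close>

lemma eventually_density:
  fixes p :: "nat \<Rightarrow> real"
  assumes "\<forall>n\<ge>1. 0 < p n \<and> p n < 1"
    and "filterlim (\<lambda>n. p n / (real n powr (- 2 / (real r + 2)))) at_top sequentially"
    and "1 \<le> B"
  shows "eventually (\<lambda>n. B \<le> (real n)\<^sup>2 * p n ^ (r + 2)) sequentially"
proof -
  have "eventually (\<lambda>n. B \<le> p n / (real n powr (- 2 / (real r + 2)))) sequentially"
    using assms(2) by (simp add: filterlim_at_top)
  then show ?thesis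
    using eventually_ge_at_top[of 1]
  proof eventually_elim
    case (elim n)
    have "B \<le> B ^ (r + 2)" using assms(3) by (intro self_le_power) auto
    also have "\<dots> \<le> (p n / (real n powr (- 2 / (real r + 2)))) ^ (r + 2)"
      using elim assms(3) by (intro power_mono) auto
    also have "\<dots> = p n ^ (r + 2) / (real n powr (- 2 / (real r + 2))) ^ (r + 2)"
      by (rule power_divide)
    also have "(real n powr (- 2 / (real r + 2))) ^ (r + 2) = real n powr (- 2 / (real r + 2) * (real r + 2))"
    proof -
      have "(real n powr (- 2 / (real r + 2))) ^ (r + 2) = (real n powr (- 2 / (real r + 2))) powr real (r + 2)"
        using elim(2) by (intro powr_realpow[symmetric]) simp
      then show ?thesis by (simp only: powr_powr) (simp add: algebra_simps)
    qed
    also have "- 2 / (real r + 2) * (real r + 2) = - 2"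
      by (simp add: field_simps)
    also have "real n powr (- 2) = 1 / (real n)\<^sup>2"
      using elim by (simp add: powr_minus_divide)
    finally show ?case by (simp add: mult.commute)
  qed
qed

theorem theorem1p2:
  fixes r :: nat
  assumes "r \<ge> 2"
  shows "\<exists>C::real. C > 0 \<and>
    (\<forall>(p :: nat \<Rightarrow> real) (t :: nat \<Rightarrow> nat).
      (\<forall>n\<ge>1. 0 < p n \<and> p n < 1) \<longrightarrow>
      filterlim (\<lambda>n. p n / (real n powr (- 2 / (real r + 2)))) at_top sequentially \<longrightarrow>
      (\<forall>n\<ge>1. real (t n) \<ge> C / p n) \<longrightarrow>
      (\<lambda>n. measure_pmf.prob (random_graph (r * n + t n) (p n))
              {G. ramsey_arrow G (complete_ugraph (r + 1)) (path_ugraph n)}) \<longlonglongrightarrow> 1)"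
proof -
  \<comment> \<open>With \<open>m = n div d\<close>, the condition
    \<open>(r + 6) * m \<le> n\<close> holds. The union bound will cost a factor of at most
    \<open>2 ^ (K * n)\<close>, and \<open>c\<close> makes \<open>c * m / 2 ^ (r + 3)\<close> at
    least \<open>(K + 1) * n\<close>, as \<open>n \<le> 2 * d * m\<close>.\<close>
  define d where "d = r + 6"
  define K :: nat where "K = (2 * r + 1) * (r + 1)"
  define c :: real where "c = 2 ^ (r + 3) * (2 * real d) * (real K + 1)"
  have c1: "1 \<le> c"
  proof -
    have "1 * 1 * 1 \<le> 2 ^ (r + 3) * (2 * real d) * (real K + 1)"
      by (intro mult_mono one_le_power) (auto simp: d_def)
    then show ?thesis by (simp add: c_def)
  qed
  \<comment> \<open>\<open>a\<close> will be \<open>c / p\<close> rounded up, hence at most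
    \<open>2 * c / p\<close>, and \<open>r + 1\<close> copies of it must fit into
    \<open>t\<close>.\<close>
  define C where "C = 2 * (real r + 1) * c"
  have "C > 0" using c1 by (simp add: C_def)
  moreover have "(\<lambda>n. measure_pmf.prob (random_graph (r * n + t n) (p n))
              {G. ramsey_arrow G (complete_ugraph (r + 1)) (path_ugraph n)}) \<longlonglongrightarrow> 1"
    if p: "\<forall>n\<ge>1. 0 < p n \<and> p n < 1"
      and dense: "filterlim (\<lambda>n. p n / (real n powr (- 2 / (real r + 2)))) at_top sequentially"
      and t: "\<forall>n\<ge>1. real (t n) \<ge> C / p n" for p :: "nat \<Rightarrow> real" and t :: "nat \<Rightarrow> nat"
  proof (rule tendsto_sandwich[where f = "\<lambda>n. 1 - exp (- real n)" and h = "\<lambda>_. 1"])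
    \<comment> \<open>This threshold serves twice: it yields \<open>a \<le> m\<close> through
      \<open>4 * d * c \<le> n * p\<close>, and \<open>1 \<le> m\<^sup>2 * p ^ (r + 2)\<close> after
      passing from \<open>n\<close> to \<open>m\<close>.\<close>
    have "1 \<le> (4 * real d * c)\<^sup>2"
    proof (intro one_le_power)
      have "1 * 1 \<le> (4 * real d) * c" using c1 by (intro mult_mono) (auto simp: d_def)
      then show "1 \<le> 4 * real d * c" by simp
    qed
    then have "eventually (\<lambda>n. (4 * real d * c)\<^sup>2 \<le> (real n)\<^sup>2 * p n ^ (r + 2)) sequentially"
      by (rule eventually_density[OF p dense])
    then show "eventually (\<lambda>n. 1 - exp (- real n) \<le> measure_pmf.prob (random_graph (r * n + t n) (p n))
              {G. ramsey_arrow G (complete_ugraph (r + 1)) (path_ugraph n)}) sequentially"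
      using eventually_ge_at_top[of "2 * d"]
    proof eventually_elim
      case (elim n)
      define m where "m = n div d"
      define a where "a = nat \<lceil>c / p n\<rceil>"
      have "n \<ge> 1" using elim by (simp add: d_def)
      then have pn: "0 < p n" "p n < 1" using p by auto
      have dm: "d * m \<le> n" by (simp add: m_def)
      have "0 < d" by (simp add: d_def)
      then have "n < d * m + d"
        using mult_div_mod_eq[of d n] mod_less_divisor[of d n] unfolding m_def by linarith
      \<comment> \<open>As \<open>2 * d \<le> n\<close>, rounding in \<open>n div d\<close> loses at
        most half.\<close>
      then have "n \<le> 2 * d * m" using elim by simp
      then have m: "real n \<le> 2 * real d * real m"
        by (metis of_nat_le_iff of_nat_mult of_nat_numeral)
      \<comment> \<open>The density condition thereby bounds \<open>(n * p)\<^sup>2\<close> from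
        below.\<close>
      have "p n ^ (r + 2) \<le> (p n)\<^sup>2" using pn by (intro power_decreasing) auto
      then have "(4 * real d * c)\<^sup>2 \<le> (real n * p n)\<^sup>2"
        using elim(1) mult_left_mono[of "p n ^ (r + 2)" "(p n)\<^sup>2" "(real n)\<^sup>2"]
        unfolding power_mult_distrib[of "real n"] by simp
      then have np: "4 * real d * c \<le> real n * p n"
        by (rule power2_le_imp_le) (use pn in simp)
      have "1 \<le> c / p n" using c1 pn by (simp add: pos_le_divide_eq)
      moreover have "real a = of_int \<lceil>c / p n\<rceil>" using calculation by (simp add: a_def)
      ultimately have a: "c / p n \<le> real a" "real a \<le> 2 * (c / p n)" "1 \<le> a"
        by linarith+
      have "(4 * real d * c) / p n \<le> real n" using np pn(1) by (simp add: pos_divide_le_eq)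
      then have "2 * real d * (2 * (c / p n)) \<le> real n" by simp
      then have "2 * real d * real a \<le> 2 * real d * real m"
        using m mult_left_mono[OF a(2), of "2 * real d"] by linarith
      then have "a \<le> m" by (simp add: d_def)
      have "(real n)\<^sup>2 * p n ^ (r + 2) \<le> (2 * real d * real m)\<^sup>2 * p n ^ (r + 2)"
        using m pn by (intro mult_right_mono power_mono) auto
      also have "\<dots> = (2 * real d)\<^sup>2 * ((real m)\<^sup>2 * p n ^ (r + 2))"
        by (simp only: power_mult_distrib[of "2 * real d" "real m"] ab_semigroup_mult_class.mult_ac(1)[of "_\<^sup>2"])
      finally have "(real n)\<^sup>2 * p n ^ (r + 2) \<le> (2 * real d)\<^sup>2 * ((real m)\<^sup>2 * p n ^ (r + 2))" .
      moreover have "(2 * real d)\<^sup>2 \<le> (4 * real d * c)\<^sup>2"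
        using mult_left_mono[OF c1, of "4 * real d"] by (intro power_mono) linarith+
      ultimately have "(2 * real d)\<^sup>2 * 1 \<le> (2 * real d)\<^sup>2 * ((real m)\<^sup>2 * p n ^ (r + 2))"
        using elim(1) by linarith
      then have mp: "1 \<le> (real m)\<^sup>2 * p n ^ (r + 2)"
        using \<open>0 < d\<close> by (subst (asm) mult_le_cancel_left_pos) auto
      have "real ((r + 1) * a) \<le> (real r + 1) * (2 * (c / p n))"
        using mult_left_mono[OF a(2), of "real r + 1"] by (simp add: algebra_simps)
      also have "\<dots> = C / p n" by (simp add: C_def)
      also have "\<dots> \<le> real (t n)" using t \<open>n \<ge> 1\<close> by blast
      finally have at: "(r + 1) * a \<le> t n" by linarith
      define X where "X = (r * n + (r + 1) * a) * (r + 1)"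
      have "(r + 1) * a \<le> d * m" using \<open>a \<le> m\<close> by (intro mult_le_mono) (auto simp: d_def)
      then have "r * n + (r + 1) * a \<le> (2 * r + 1) * n" using dm by (simp add: algebra_simps)
      then have "X \<le> ((2 * r + 1) * n) * (r + 1)"
        unfolding X_def by (rule mult_le_mono1)
      then have X: "X \<le> K * n" by (simp only: K_def mult_ac)
      have "2 ^ X \<le> exp (real X)"
        using power_mono[of "2::real" "exp 1" X] exp_ge_add_one_self[of 1] by (simp add: exp_of_nat_mult[symmetric])
      also have "\<dots> \<le> exp (real K * real n)" using X by (simp flip: of_nat_mult)
      finally have X': "2 ^ X \<le> exp (real K * real n)" .
      have "c * real m / 2 ^ (r + 3) = (real K + 1) * (2 * real d * real m)"
        by (simp add: c_def)
      then have "(real K + 1) * real n \<le> c * real m / 2 ^ (r + 3)"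
        using m mult_left_mono[OF m, of "real K + 1"] by simp
      \<comment> \<open>The extra 1 in \<open>K + 1\<close> leaves \<open>exp (- n)\<close> once the
        number of candidates is cancelled.\<close>
      then have "2 ^ X * exp (- (c * real m) / 2 ^ (r + 3)) \<le> exp (real K * real n) * exp (- ((real K + 1) * real n))"
        using X' by (intro mult_mono) auto
      also have "\<dots> = exp (- real n)" by (simp add: algebra_simps flip: exp_add)
      finally have "2 ^ X * exp (- (c * real m) / 2 ^ (r + 3)) \<le> exp (- real n)" .
      moreover have "1 - 2 ^ X * exp (- (c * real m) / 2 ^ (r + 3)) \<le>
          measure_pmf.prob (random_graph (r * n + t n) (p n))
            {G. ramsey_arrow G (complete_ugraph (r + 1)) (path_ugraph n)}"
        unfolding X_def using assms pn c1 a \<open>a \<le> m\<close> mp dm at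
        by (intro prob_ramsey_arrow_ge) (auto simp: d_def field_simps)
      ultimately show ?case by linarith
    qed
    show "(\<lambda>n. 1 - exp (- real n)) \<longlonglongrightarrow> 1" by real_asymp
  qed auto
  ultimately show ?thesis by blast
qed

end
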